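(* For every completely multiplicative function $f:\mathbb{N}\to\mathbb{T}$ we have $$\liminf_{n\to\infty}|f(n+1)-f(n)|=0.$$
   Context: $\mathbb{T}=\{z\in\mathbb{C}:|z|=1\}$ denotes the unit circle. *)

theory Defs
  imports "HOL-Analysis.Analysis"
begin

(* Arithmetic functions live on the positive integers; the value at 0 is a junk value and is
   left unconstrained.  The normalisation f 1 = 1 is not part of the definition: it follows
   from f 1 = f 1 * f 1 as soon as f 1 is nonzero, in particular for unimodular f. *)
definition completely_multiplicative :: "(nat \<Rightarrow> complex) \<Rightarrow> bool" where
  "completely_multiplicative f \<longleftrightarrow> (\<forall>m\<ge>1. \<forall>n\<ge>1. f (m * n) = f m * f n)"

abbreviation unit_circle :: "complex set" ("\<T>") where
  "\<T> \<equiv> {z. norm z = 1}"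

end

theory Submission
  imports Defs
begin

text \<open>
  There are arbitrarily large finite sets of positive integers in which every difference
  \<open>b - a\<close> of two elements \<open>a < b\<close> divides \<open>a\<close>: from such a set \<open>A\<close> one obtains a larger one by
  taking a multiple \<open>L\<close> of all elements and differences of \<open>A\<close> and passing to
  \<open>{L} \<union> (L + A)\<close>. Then \<open>b / a = (n + 1) / n\<close> with \<open>n = a / (b - a)\<close>, which is large if \<open>L\<close> is,
  and so \<open>|f b - f a| = |f (n + 1) - f n|\<close>. If the set has sufficiently many
  elements, the pigeonhole principle on the circle makes one of these distances small.
\<close>

lemma ex_set_differences_dvd:
  fixes N k :: nat
  shows "\<exists>A. finite A \<and> card A = k \<and> (\<forall>a\<in>A. 0 < a) \<and>
    (\<forall>a\<in>A. \<forall>b\<in>A. a < b \<longrightarrow> (b - a) dvd a \<and> N * (b - a) \<le> a)"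
proof (induction k)
  case 0
  show ?case by (intro exI[of _ "{}"]) simp
next
  case (Suc k)
  then obtain A :: "nat set" where A: "finite A" "card A = k" and pos: "\<And>a. a \<in> A \<Longrightarrow> 0 < a"
    and dvd: "\<And>a b. a \<in> A \<Longrightarrow> b \<in> A \<Longrightarrow> a < b \<Longrightarrow> (b - a) dvd a"
    by blast
  obtain m where m: "\<And>a. a \<in> A \<Longrightarrow> a \<le> m"
    using A(1) by (meson finite_nat_set_iff_bounded_le)
  \<comment> \<open>\<open>fact m\<close> is a multiple of every d with 0 < d \<le> m, hence of all
    elements and differences of \<open>A\<close>. The factor \<open>Suc N\<close> yields the size
    bound and keeps \<open>L\<close> positive even for \<open>N\<close> = 0.\<close>
  define L where "L = Suc N * fact m"
  have L_dvd: "d dvd L" and L_ge: "N * d \<le> L" if "0 < d" "d \<le> m" for d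
  proof -
    show "d dvd L"
      using that by (simp add: L_def dvd_fact del: mult_Suc)
    have "d \<le> fact m"
      using that(2) fact_ge_self le_trans by blast
    then show "N * d \<le> L"
      unfolding L_def by (intro mult_le_mono) auto
  qed
  have "0 < L" by (simp add: L_def)
  have "L \<notin> (+) L ` A"
    using pos by fastforce
  then have "card (insert L ((+) L ` A)) = Suc k"
    using A by (simp add: card_image)
  moreover have "(b - a) dvd a \<and> N * (b - a) \<le> a"
    if a: "a \<in> insert L ((+) L ` A)" and b: "b \<in> insert L ((+) L ` A)" and "a < b" for a b
  proof -
    \<comment> \<open>\<open>L\<close> is the minimum of the new set, so the larger element
      \<open>b\<close> lies in the shifted copy.\<close>
    obtain y where y: "y \<in> A" "b = L + y"
      using a b \<open>a < b\<close> by auto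
    show ?thesis
    proof (cases "a = L")
      case True
      then show ?thesis
        using y pos[of y] m[of y] L_dvd[of y] L_ge[of y] by simp
    next
      case False
      then obtain x where x: "x \<in> A" "a = L + x"
        using a by auto
      \<comment> \<open>The shift preserves the difference, which divides both \<open>L\<close> and
        \<open>x\<close>, hence also \<open>L + x\<close>.\<close>
      have xy: "x < y" "y \<le> m"
        using \<open>a < b\<close> x y m by auto
      then have "(y - x) dvd L" "N * (y - x) \<le> L"
        by (auto intro!: L_dvd L_ge)
      then show ?thesis
        using x y xy dvd[of x y] by auto
    qed
  qed
  ultimately show ?case
    using A(1) \<open>0 < L\<close> by (intro exI[of _ "insert L ((+) L ` A)"]) auto
qed

text \<open>Pigeonhole on a finite cover by balls of radius e/2, with one more index than balls. The
  number k depends only on \<open>S\<close> and \<open>e\<close>, and it is the indices that are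
  distinct: \<open>g\<close> may repeat values.\<close>

lemma ex_close_pair_of_card:
  fixes S :: "'a::metric_space set"
  assumes "compact S" "0 < e"
  shows "\<exists>k. \<forall>(A :: 'b set) g. finite A \<longrightarrow> card A = k \<longrightarrow> g ` A \<subseteq> S \<longrightarrow>
    (\<exists>a\<in>A. \<exists>b\<in>A. a \<noteq> b \<and> dist (g a) (g b) < e)"
proof -
  obtain C where C: "finite C" "S \<subseteq> (\<Union>c\<in>C. ball c (e / 2))"
    using compact_eq_totally_bounded[of S] assms half_gt_zero by meson
  have "\<exists>a\<in>A. \<exists>b\<in>A. a \<noteq> b \<and> dist (g a) (g b) < e"
    if A: "finite A" "card A = Suc (card C)" "g ` A \<subseteq> S" for A :: "'b set" and g
  proof -
    have "\<forall>a\<in>A. \<exists>c\<in>C. dist c (g a) < e / 2"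
      using C(2) A(3) by (force simp: subset_iff)
    then obtain h where h: "\<And>a. a \<in> A \<Longrightarrow> h a \<in> C" "\<And>a. a \<in> A \<Longrightarrow> dist (h a) (g a) < e / 2"
      by metis
    have "card (h ` A) < card A"
      using A C(1) h(1) by (metis card_mono image_subsetI le_imp_less_Suc)
    then obtain a b where ab: "a \<in> A" "b \<in> A" "a \<noteq> b" "h a = h b"
      using pigeonhole unfolding inj_on_def by blast
    then have "dist (g a) (g b) < e"
      using h(2) by (metis dist_commute dist_triangle_half_r)
    then show ?thesis
      using ab by blast
  qed
  then show ?thesis by blast
qed

lemma ex_close_consecutive_values:
  fixes f :: "nat \<Rightarrow> complex"
  assumes f: "f \<in> {1..} \<rightarrow> \<T>" "completely_multiplicative f" and "0 < e"
  shows "\<exists>n\<ge>N. norm (f (n + 1) - f n) < e"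
proof -
  have "compact \<T>"
    using compact_sphere[of "0 :: complex" 1] by (simp add: sphere_def)
  then obtain k where k: "\<And>(A :: nat set) g. \<lbrakk>finite A; card A = k; g ` A \<subseteq> \<T>\<rbrakk> \<Longrightarrow>
      \<exists>a\<in>A. \<exists>b\<in>A. a \<noteq> b \<and> dist (g a) (g b) < e"
    using ex_close_pair_of_card[OF _ \<open>0 < e\<close>] by metis
  obtain A where A: "finite A" "card A = k" "\<forall>a\<in>A. 0 < a"
    and dvd: "\<forall>a\<in>A. \<forall>b\<in>A. a < b \<longrightarrow> (b - a) dvd a \<and> N * (b - a) \<le> a"
    using ex_set_differences_dvd by blast
  have "f ` A \<subseteq> \<T>"
    using f(1) A(3) by force
  from k[OF A(1,2) this] obtain a b where ab: "a \<in> A" "b \<in> A" "a < b" "dist (f a) (f b) < e"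
    by (metis dist_commute nat_neq_iff)
  define d where "d = b - a"
  obtain n where n: "a = d * n"
    using dvd ab unfolding d_def by blast
  have "0 < d" and b: "b = a + d"
    using ab(3) by (simp_all add: d_def)
  have "0 < a" "N * d \<le> a"
    using dvd ab A(3) by (simp_all add: d_def)
  \<comment> \<open>Positivity of \<open>n\<close> is recorded separately because \<open>N\<close>
    may be 0, while multiplicativity is available only for positive arguments.\<close>
  then have "0 < n" "N \<le> n"
    using n \<open>0 < d\<close> by (simp_all add: mult.commute)
  have "b = d * (n + 1)"
    using n b by simp
  then have "f b = f d * f (n + 1)" "f a = f d * f n"
    using f(2) n \<open>0 < d\<close> \<open>0 < n\<close>
    by (simp_all add: completely_multiplicative_def Suc_le_eq del: mult_Suc_right)
  then have "f b - f a = f d * (f (n + 1) - f n)"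
    by (simp add: right_diff_distrib)
  moreover have "norm (f d) = 1"
    using f(1) \<open>0 < d\<close> by (auto simp: Pi_iff Suc_le_eq)
  ultimately have "norm (f (n + 1) - f n) < e"
    using ab(4) by (metis dist_commute dist_norm mult_1 norm_mult)
  then show ?thesis
    using \<open>N \<le> n\<close> by blast
qed

theorem theorem1p1:
  fixes f :: "nat \<Rightarrow> complex"
  assumes "f \<in> {1..} \<rightarrow> \<T>"
    and "completely_multiplicative f"
  shows "liminf (\<lambda>n. ereal (norm (f (n + 1) - f n))) = 0"
proof (rule antisym)
  show "liminf (\<lambda>n. ereal (norm (f (n + 1) - f n))) \<le> 0"
  proof (rule ereal_le_epsilon2)
    fix e :: real
    assume "0 < e"
    \<comment> \<open>The liminf is the supremum over \<open>N\<close> of these tail infima, and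
      every tail contains a value below \<open>e\<close>.\<close>
    have "(INF n\<in>{N..}. ereal (norm (f (n + 1) - f n))) \<le> ereal e" for N
      using ex_close_consecutive_values[OF assms \<open>0 < e\<close>, of N]
      by (auto intro: INF_lower2 less_imp_le)
    then show "liminf (\<lambda>n. ereal (norm (f (n + 1) - f n))) \<le> 0 + ereal e"
      by (simp add: liminf_SUP_INF SUP_least)
  qed
  show "0 \<le> liminf (\<lambda>n. ereal (norm (f (n + 1) - f n)))"
    by (intro Liminf_bounded always_eventually) simp
qed

end
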